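(* Let $F$ be a field of characteristic $0$, and let $B(F)=\ker\partial/H$ and $\mathcal{B}(F)=\ker\varphi/I$ be the two kinds of Bloch groups of $F$ defined in the context. Then $B(F)$ and $\mathcal{B}(F)$ are different by torsion. Furthermore, $$B(F)\otimes\mathbb{Z}[\tfrac16]\cong \mathcal{B}(F)\otimes\mathbb{Z}[\tfrac16].$$
   Context: Let $F$ be a field of characteristic $0$ and let $\mathbb{Z}[F]$ denote the free abelian group on symbols $[a]$, $a\in F^\times$, $a\neq 1$. All tensor products are over $\mathbb{Z}$, with $F^\times$ regarded as an abelian group under multiplication. First version. Let $F^\times\wedge F^\times := F^\times\otimes F^\times/\langle a\otimes(-a) : a\in F^\times\rangle$, and let $\partial:\mathbb{Z}[F]\to F^\times\wedge F^\times$ be the homomorphism with $\partial([a])=\overline{a\otimes(1-a)}$. Let $H\subseteq\mathbb{Z}[F]$ be the subgroup generated by all elements $$[a]+[1-a],\qquad [a]+[a^{-1}],\qquad [a]+[b]+\left[\tfrac{1-a}{1-ab}\right]+[1-ab]+\left[\tfrac{1-b}{1-ab}\right],$$ with $a,b\in F^\times\setminus\{1\}$, $ab\neq 1$ (the first two families for all $a\in F^\times\setminus\{1\}$). Then $H\subseteq\ker\partial$, and $B(F):=\ker\partial/H$. Second version (Suslin). Let $\varphi:\mathbb{Z}[F]\to F^\times\otimes F^\times/\langle x\otimes y+y\otimes x : x,y\in F^\times\rangle$ be the homomorphism with $\varphi([a])=\overline{a\otimes(1-a)}$. Let $I\subseteq\mathbb{Z}[F]$ be the subgroup generated by all elements $$[x]-[y]+\left[\tfrac{y}{x}\right]-\left[\tfrac{1-x^{-1}}{1-y^{-1}}\right]+\left[\tfrac{1-x}{1-y}\right],\qquad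 x,y\in F^\times\setminus\{1\},\ x\neq y.$$ Then $I\subseteq\ker\varphi$, and $\mathcal{B}(F):=\ker\varphi/I$. *)

theory Defs
  imports "HOL-Algebra.Algebra"
begin

section \<open>Abelian groups: linear extension, tensor product, torsion\<close>

text \<open>The homomorphism from \<^term>\<open>free_Abelian_group S\<close> to the abelian group \<open>G\<close> (written
  multiplicatively) that extends \<open>f : S \<rightarrow> G\<close>.\<close>

definition free_lift :: "('b, 'm) monoid_scheme \<Rightarrow> ('a \<Rightarrow> 'b) \<Rightarrow> ('a \<Rightarrow>\<^sub>0 int) \<Rightarrow> 'b" where
  "free_lift G f c = finprod G (\<lambda>a. f a [^]\<^bsub>G\<^esub> Poly_Mapping.lookup c a) (Poly_Mapping.keys c)"

definition tensor_rel ::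
  "('a, 'm) monoid_scheme \<Rightarrow> ('b, 'n) monoid_scheme \<Rightarrow> (('a \<times> 'b) \<Rightarrow>\<^sub>0 int) set" where
  "tensor_rel G H = generate (free_Abelian_group (carrier G \<times> carrier H))
     ({frag_of (x \<otimes>\<^bsub>G\<^esub> x', y) - frag_of (x, y) - frag_of (x', y) | x x' y.
         x \<in> carrier G \<and> x' \<in> carrier G \<and> y \<in> carrier H} \<union>
      {frag_of (x, y \<otimes>\<^bsub>H\<^esub> y') - frag_of (x, y) - frag_of (x, y') | x y y'.
         x \<in> carrier G \<and> y \<in> carrier H \<and> y' \<in> carrier H})"

text \<open>The tensor product over the integers of two abelian groups, both written multiplicatively.\<close>

definition tensor_group ::
  "('a, 'm) monoid_scheme \<Rightarrow> ('b, 'n) monoid_scheme \<Rightarrow> (('a \<times> 'b) \<Rightarrow>\<^sub>0 int) set monoid" where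
  "tensor_group G H = free_Abelian_group (carrier G \<times> carrier H) Mod tensor_rel G H"

definition pure_tensor ::
  "('a, 'm) monoid_scheme \<Rightarrow> ('b, 'n) monoid_scheme \<Rightarrow> 'a \<Rightarrow> 'b \<Rightarrow> (('a \<times> 'b) \<Rightarrow>\<^sub>0 int) set" where
  "pure_tensor G H x y =
     tensor_rel G H #>\<^bsub>free_Abelian_group (carrier G \<times> carrier H)\<^esub> frag_of (x, y)"

definition torsion_group :: "('a, 'm) monoid_scheme \<Rightarrow> bool" where
  "torsion_group G \<longleftrightarrow> (\<forall>x\<in>carrier G. \<exists>n::nat. n > 0 \<and> x [^]\<^bsub>G\<^esub> n = \<one>\<^bsub>G\<^esub>)"

text \<open>The additive group of \<open>\<int>[1/6]\<close>. Group homomorphisms between \<open>\<int>[1/6]\<close>-modules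
  are automatically \<open>\<int>[1/6]\<close>-linear, so only the group structure is needed.\<close>

definition Z_inv6 :: "rat monoid" where
  "Z_inv6 = \<lparr>carrier = {of_int k / 6 ^ n | (k::int) (n::nat). True}, monoid.mult = (+), one = 0\<rparr>"

lemma comm_group_Z_inv6: "comm_group Z_inv6"
proof (rule comm_groupI)
  fix x y assume "x \<in> carrier Z_inv6" "y \<in> carrier Z_inv6"
  then obtain k n l m where "x = of_int k / 6 ^ n" "y = of_int l / 6 ^ m"
    by (auto simp: Z_inv6_def)
  then have "x + y = of_int (k * 6 ^ m + l * 6 ^ n) / 6 ^ (n + m)"
    by (simp add: add_divide_distrib power_add)
  then show "x \<otimes>\<^bsub>Z_inv6\<^esub> y \<in> carrier Z_inv6"
    unfolding Z_inv6_def by (simp del: of_int_add of_int_mult) blast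
next
  have "(0::rat) = of_int 0 / 6 ^ 0" by simp
  then show "\<one>\<^bsub>Z_inv6\<^esub> \<in> carrier Z_inv6"
    unfolding Z_inv6_def by auto
next
  fix x assume "x \<in> carrier Z_inv6"
  then obtain k n where "x = of_int k / 6 ^ n"
    by (auto simp: Z_inv6_def)
  then have "- x = of_int (- k) / 6 ^ n" by simp
  then have "- x \<in> carrier Z_inv6"
    unfolding Z_inv6_def by (simp del: of_int_minus) blast
  then show "\<exists>y\<in>carrier Z_inv6. y \<otimes>\<^bsub>Z_inv6\<^esub> x = \<one>\<^bsub>Z_inv6\<^esub>"
    by (intro bexI[of _ "- x"]) (auto simp: Z_inv6_def)
qed (auto simp: Z_inv6_def)

lemma free_lift_hom:
  assumes "comm_group G" "f \<in> S \<rightarrow> carrier G"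
  shows "free_lift G f \<in> hom (free_Abelian_group S) G"
    and "\<And>a. a \<in> S \<Longrightarrow> free_lift G f (frag_of a) = f a"
proof -
  interpret G: comm_group G by fact
  have lift: "free_lift G f c = finprod G (\<lambda>a. f a [^]\<^bsub>G\<^esub> Poly_Mapping.lookup c a) A"
    if "finite A" "Poly_Mapping.keys c \<subseteq> A" "A \<subseteq> S" for c A
    unfolding free_lift_def using that assms(2)
    by (intro G.finprod_mono_neutral_cong_left) (auto simp: in_keys_iff)
  show "free_lift G f \<in> hom (free_Abelian_group S) G"
  proof (rule homI)
    fix c assume "c \<in> carrier (free_Abelian_group S)"
    then show "free_lift G f c \<in> carrier G"
      using assms(2) unfolding free_lift_def
      by (intro G.finprod_closed) (auto simp: free_Abelian_group_def)
  next
    fix c d assume "c \<in> carrier (free_Abelian_group S)" "d \<in> carrier (free_Abelian_group S)"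
    then have sub: "Poly_Mapping.keys c \<union> Poly_Mapping.keys d \<subseteq> S"
      by (auto simp: free_Abelian_group_def)
    let ?A = "Poly_Mapping.keys c \<union> Poly_Mapping.keys d"
    have fA: "f a \<in> carrier G" if "a \<in> ?A" for a
      using that sub assms(2) by blast
    have "free_lift G f (c + d) = finprod G (\<lambda>a. f a [^]\<^bsub>G\<^esub> Poly_Mapping.lookup (c + d) a) ?A"
      using sub Poly_Mapping.keys_add[of c d] by (intro lift) auto
    also have "\<dots> = finprod G (\<lambda>a. f a [^]\<^bsub>G\<^esub> Poly_Mapping.lookup c a \<otimes>\<^bsub>G\<^esub>
                         f a [^]\<^bsub>G\<^esub> Poly_Mapping.lookup d a) ?A"
      using fA by (intro G.finprod_cong') (auto simp: lookup_add G.int_pow_mult)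
    also have "\<dots> = finprod G (\<lambda>a. f a [^]\<^bsub>G\<^esub> Poly_Mapping.lookup c a) ?A \<otimes>\<^bsub>G\<^esub>
                    finprod G (\<lambda>a. f a [^]\<^bsub>G\<^esub> Poly_Mapping.lookup d a) ?A"
      using fA by (intro G.finprod_multf) auto
    also have "\<dots> = free_lift G f c \<otimes>\<^bsub>G\<^esub> free_lift G f d"
      using sub lift[of ?A c] lift[of ?A d] by simp
    finally show "free_lift G f (c \<otimes>\<^bsub>free_Abelian_group S\<^esub> d) =
        free_lift G f c \<otimes>\<^bsub>G\<^esub> free_lift G f d"
      by (simp add: free_Abelian_group_def)
  qed
  show "free_lift G f (frag_of a) = f a" if "a \<in> S" for a
    using lift[of "{a}" "frag_of a"] that assms(2) by (auto simp: Pi_iff G.int_pow_1)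
qed

lemma comm_group_tensor_group:
  assumes "comm_group G" "comm_group H"
  shows "comm_group (tensor_group G H)"
proof -
  interpret G: comm_group G by fact
  interpret H: comm_group H by fact
  let ?A = "free_Abelian_group (carrier G \<times> carrier H)"
  interpret A: comm_group ?A by (rule abelian_free_Abelian_group)
  have d: "x - y \<in> carrier ?A" if "x \<in> carrier ?A" "y \<in> carrier ?A" for x y
    using that Poly_Mapping.keys_diff[of x y] by (auto simp: free_Abelian_group_def)
  have "subgroup (tensor_rel G H) ?A"
    unfolding tensor_rel_def
    by (intro A.generate_is_subgroup) (auto intro!: d simp: frag_of_in_free_Abelian_group)
  then show ?thesis
    unfolding tensor_group_def by (rule A.abelian_FactGroup)
qed

section \<open>The two Bloch groups\<close>

definition units_group :: "'f::field monoid" where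
  "units_group = \<lparr>carrier = UNIV - {0}, monoid.mult = (*), one = 1\<rparr>"

definition ZF :: "('f::field \<Rightarrow>\<^sub>0 int) monoid" where
  "ZF = free_Abelian_group (UNIV - {0, 1})"

abbreviation FxF :: "(('f::field \<times> 'f) \<Rightarrow>\<^sub>0 int) set monoid" where
  "FxF \<equiv> tensor_group units_group units_group"

abbreviation ptensor :: "'f::field \<Rightarrow> 'f \<Rightarrow> (('f \<times> 'f) \<Rightarrow>\<^sub>0 int) set" where
  "ptensor \<equiv> pure_tensor units_group units_group"

subsection \<open>First version\<close>

definition wedge_rel :: "(('f::field \<times> 'f) \<Rightarrow>\<^sub>0 int) set set" where
  "wedge_rel = generate FxF {ptensor a (- a) | a. a \<noteq> 0}"

definition wedge_group :: "(('f::field \<times> 'f) \<Rightarrow>\<^sub>0 int) set set monoid" where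
  "wedge_group = FxF Mod wedge_rel"

definition bloch_boundary :: "('f::field \<Rightarrow>\<^sub>0 int) \<Rightarrow> (('f \<times> 'f) \<Rightarrow>\<^sub>0 int) set set" where
  "bloch_boundary = free_lift wedge_group (\<lambda>a. wedge_rel #>\<^bsub>FxF\<^esub> ptensor a (1 - a))"

definition bloch_rel :: "('f::field \<Rightarrow>\<^sub>0 int) set" where
  "bloch_rel = generate ZF
     ({frag_of a + frag_of (1 - a) | a. a \<notin> {0, 1}} \<union>
      {frag_of a + frag_of (inverse a) | a. a \<notin> {0, 1}} \<union>
      {frag_of a + frag_of b + frag_of ((1 - a) / (1 - a * b)) + frag_of (1 - a * b)
         + frag_of ((1 - b) / (1 - a * b)) | a b. a \<notin> {0, 1} \<and> b \<notin> {0, 1} \<and> a * b \<noteq> 1})"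

definition bloch_ker :: "('f::field \<Rightarrow>\<^sub>0 int) set" where
  "bloch_ker = kernel ZF wedge_group bloch_boundary"

definition bloch_group :: "('f::field \<Rightarrow>\<^sub>0 int) set monoid" where
  "bloch_group = (ZF\<lparr>carrier := bloch_ker\<rparr>) Mod bloch_rel"

subsection \<open>Second version (Suslin)\<close>

definition suslin_wedge_rel :: "(('f::field \<times> 'f) \<Rightarrow>\<^sub>0 int) set set" where
  "suslin_wedge_rel =
     generate FxF {ptensor x y \<otimes>\<^bsub>FxF\<^esub> ptensor y x | x y. x \<noteq> 0 \<and> y \<noteq> 0}"

definition suslin_wedge_group :: "(('f::field \<times> 'f) \<Rightarrow>\<^sub>0 int) set set monoid" where
  "suslin_wedge_group = FxF Mod suslin_wedge_rel"

definition suslin_boundary :: "('f::field \<Rightarrow>\<^sub>0 int) \<Rightarrow> (('f \<times> 'f) \<Rightarrow>\<^sub>0 int) set set" where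
  "suslin_boundary =
     free_lift suslin_wedge_group (\<lambda>a. suslin_wedge_rel #>\<^bsub>FxF\<^esub> ptensor a (1 - a))"

definition suslin_rel :: "('f::field \<Rightarrow>\<^sub>0 int) set" where
  "suslin_rel = generate ZF
     {frag_of x - frag_of y + frag_of (y / x)
        - frag_of ((1 - inverse x) / (1 - inverse y)) + frag_of ((1 - x) / (1 - y)) | x y.
        x \<notin> {0, 1} \<and> y \<notin> {0, 1} \<and> x \<noteq> y}"

definition suslin_ker :: "('f::field \<Rightarrow>\<^sub>0 int) set" where
  "suslin_ker = kernel ZF suslin_wedge_group suslin_boundary"

definition suslin_bloch_group :: "('f::field \<Rightarrow>\<^sub>0 int) set monoid" where
  "suslin_bloch_group = (ZF\<lparr>carrier := suslin_ker\<rparr>) Mod suslin_rel"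

subsection \<open>Differing by torsion\<close>

text \<open>The two groups are subquotients of the same group \<^term>\<open>ZF\<close>. They differ by torsion if the
  identity of \<^term>\<open>ZF\<close> induces a homomorphism from \<^term>\<open>suslin_bloch_group\<close> to
  \<^term>\<open>bloch_group\<close> with torsion kernel and torsion cokernel.\<close>

definition induced_by_identity ::
  "(('f::field \<Rightarrow>\<^sub>0 int) set \<Rightarrow> ('f \<Rightarrow>\<^sub>0 int) set) \<Rightarrow> bool" where
  "induced_by_identity h \<longleftrightarrow>
     (\<forall>c\<in>suslin_ker. h (suslin_rel #>\<^bsub>ZF\<^esub> c) = bloch_rel #>\<^bsub>ZF\<^esub> c)"

definition torsion_kernel_cokernel ::
  "('a, 'm) monoid_scheme \<Rightarrow> ('b, 'n) monoid_scheme \<Rightarrow> ('a \<Rightarrow> 'b) \<Rightarrow> bool" where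
  "torsion_kernel_cokernel G H h \<longleftrightarrow>
     torsion_group (G\<lparr>carrier := kernel G H h\<rparr>) \<and> torsion_group (H Mod (h ` carrier G))"

lemma comm_group_units_group: "comm_group (units_group :: 'f::field monoid)"
proof (rule comm_groupI)
  fix x :: 'f assume "x \<in> carrier units_group"
  then show "\<exists>y\<in>carrier units_group. y \<otimes>\<^bsub>units_group\<^esub> x = \<one>\<^bsub>units_group\<^esub>"
    by (intro bexI[of _ "inverse x"]) (auto simp: units_group_def)
qed (auto simp: units_group_def)

lemma ptensor_closed: "a \<noteq> 0 \<Longrightarrow> b \<noteq> 0 \<Longrightarrow> ptensor a b \<in> carrier FxF"
  by (auto simp: pure_tensor_def tensor_group_def carrier_FactGroup units_group_def
      frag_of_in_free_Abelian_group)

lemma subgroup_wedge_rel: "subgroup wedge_rel FxF"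
  and subgroup_suslin_wedge_rel: "subgroup suslin_wedge_rel FxF"
proof -
  interpret T: comm_group FxF
    by (intro comm_group_tensor_group comm_group_units_group)
  show "subgroup wedge_rel FxF"
    unfolding wedge_rel_def by (rule T.generate_is_subgroup) (auto intro!: ptensor_closed)
  show "subgroup suslin_wedge_rel FxF"
    unfolding suslin_wedge_rel_def
    by (rule T.generate_is_subgroup) (auto intro!: ptensor_closed)
qed

lemma bloch_boundary_hom: "bloch_boundary \<in> hom ZF wedge_group"
  and bloch_boundary_frag_of:
    "a \<notin> {0, 1} \<Longrightarrow> bloch_boundary (frag_of a) = wedge_rel #>\<^bsub>FxF\<^esub> ptensor a (1 - a)"
proof -
  interpret T: comm_group FxF
    by (intro comm_group_tensor_group comm_group_units_group)
  have c: "comm_group wedge_group"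
    unfolding wedge_group_def by (rule T.abelian_FactGroup[OF subgroup_wedge_rel])
  have f: "(\<lambda>a. wedge_rel #>\<^bsub>FxF\<^esub> ptensor a (1 - a)) \<in> UNIV - {0, 1} \<rightarrow> carrier wedge_group"
    by (auto simp: wedge_group_def carrier_FactGroup ptensor_closed)
  show "bloch_boundary \<in> hom ZF wedge_group"
    unfolding ZF_def bloch_boundary_def by (rule free_lift_hom(1)[OF c f])
  show "bloch_boundary (frag_of a) = wedge_rel #>\<^bsub>FxF\<^esub> ptensor a (1 - a)" if "a \<notin> {0, 1}"
    unfolding bloch_boundary_def using free_lift_hom(2)[OF c f] that by blast
qed

lemma suslin_boundary_hom: "suslin_boundary \<in> hom ZF suslin_wedge_group"
  and suslin_boundary_frag_of:
    "a \<notin> {0, 1} \<Longrightarrow>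
       suslin_boundary (frag_of a) = suslin_wedge_rel #>\<^bsub>FxF\<^esub> ptensor a (1 - a)"
proof -
  interpret T: comm_group FxF
    by (intro comm_group_tensor_group comm_group_units_group)
  have c: "comm_group suslin_wedge_group"
    unfolding suslin_wedge_group_def
    by (rule T.abelian_FactGroup[OF subgroup_suslin_wedge_rel])
  have f: "(\<lambda>a. suslin_wedge_rel #>\<^bsub>FxF\<^esub> ptensor a (1 - a)) \<in>
      UNIV - {0, 1} \<rightarrow> carrier suslin_wedge_group"
    by (auto simp: suslin_wedge_group_def carrier_FactGroup ptensor_closed)
  show "suslin_boundary \<in> hom ZF suslin_wedge_group"
    unfolding ZF_def suslin_boundary_def by (rule free_lift_hom(1)[OF c f])
  show "suslin_boundary (frag_of a) = suslin_wedge_rel #>\<^bsub>FxF\<^esub> ptensor a (1 - a)"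
    if "a \<notin> {0, 1}"
    unfolding suslin_boundary_def using free_lift_hom(2)[OF c f] that by blast
qed

end

theory Submission
  imports Defs
begin

text \<open>
  Write \<open>I\<close>, \<open>H\<close> for the relations and \<open>K\<^sub>\<phi>\<close>, \<open>K\<^sub>\<partial>\<close> for the kernels of the two versions. Suslin's
  relation at \<open>(x, y)\<close> agrees with the five-term relation at \<open>(x, 1/y)\<close> up to elements
  \<open>\<langle>a\<rangle> = [a] + [1/a]\<close> and \<open>[a] + [1 - a]\<close>, so \<open>I \<subseteq> H\<close>. Conversely, adding Suslin's relations at
  \<open>(x, y)\<close> and \<open>(y, x)\<close> shows that \<open>\<langle>p u\<rangle> = \<langle>p\<rangle> + \<langle>u\<rangle>\<close> modulo \<open>I\<close>, which forces \<open>2 \<langle>a\<rangle> = 0\<close>; subtracting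
  the relation at \<open>(1 - y, 1 - x)\<close> from the one at \<open>(x, y)\<close> shows that \<open>[a] + [1 - a]\<close> does not depend
  on \<open>a\<close>, and summing it over \<open>a\<close>, \<open>1/a\<close>, \<open>1/(1 - a)\<close> gives a sum of three elements \<open>\<langle>b\<rangle>\<close>, so it is
  killed by 6. Hence \<open>6 H \<subseteq> I\<close>. On the other side \<open>K\<^sub>\<phi> \<subseteq> K\<^sub>\<partial>\<close> and \<open>2 K\<^sub>\<partial> \<subseteq> K\<^sub>\<phi>\<close>, because
  \<open>2 (a \<otimes> (-a)) = a \<otimes> a + a \<otimes> a\<close>.

  The identity therefore induces \<open>K\<^sub>\<phi>/I \<rightarrow> K\<^sub>\<partial>/H\<close>, multiplication by 12 induces a map in the other
  direction, and both composites are multiplication by 12, which is invertible after tensoring with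
  \<open>\<int>[1/6]\<close>. Here \<open>K/R\<close> is treated as the image of \<open>K\<close> in the quotient of \<open>\<int>[F]\<close> by \<open>R\<close>.
\<close>

section \<open>Subquotients of abelian groups\<close>

lemma (in group) subgroup_nat_pow_closed:
  "subgroup R G \<Longrightarrow> c \<in> R \<Longrightarrow> c [^] (n::nat) \<in> R"
  by (induction n) (auto simp: subgroup.one_closed subgroup.m_closed)

lemma (in comm_group) subgroup_nat_pow_vimage:
  assumes "subgroup S G"
  shows "subgroup {x \<in> carrier G. x [^] (n::nat) \<in> S} G"
proof -
  interpret S: subgroup S G by fact
  show ?thesis
    by (rule subgroupI)
      (use S.one_closed in \<open>force, auto simp: nat_pow_inv nat_pow_distrib\<close>)
qed

text \<open>The elements whose \<open>n\<close>-th power lies in \<open>S\<close> form a subgroup,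
  so it is enough to check the generators. This serves both for the relations between symbols (with
  6) and for the relations in the tensor square (with 2).\<close>

lemma (in comm_group) generate_nat_pow_subset:
  assumes "subgroup S G" "B \<subseteq> carrier G" "\<And>x. x \<in> B \<Longrightarrow> x [^] (n::nat) \<in> S"
    and "x \<in> generate G B"
  shows "x [^] n \<in> S"
  using generate_subgroup_incl[OF _ subgroup_nat_pow_vimage[OF assms(1)], of B n] assms(2-4)
  by blast

lemma (in comm_group) nat_pow_hom: "(\<lambda>x. x [^] (n::nat)) \<in> hom G G"
  by (rule homI) (auto simp: nat_pow_distrib)

text \<open>Cosets and set products do not refer to the carrier, so the two records are literally
  equal. Multiplication in \<open>K/R\<close> can thus be computed in
  \<open>G Mod R\<close>.\<close>

lemma subquotient_eq:
  "(G\<lparr>carrier := K\<rparr>) Mod R = (G Mod R)\<lparr>carrier := (\<lambda>c. R #>\<^bsub>G\<^esub> c) ` K\<rparr>"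
  by (auto simp: FactGroup_def RCOSETS_def r_coset_def set_mult_def fun_eq_iff)

lemma carrier_subquotient: "carrier ((G\<lparr>carrier := K\<rparr>) Mod R) = (\<lambda>c. R #>\<^bsub>G\<^esub> c) ` K"
  by (simp add: subquotient_eq)

context comm_group
begin

lemma group_hom_r_coset: "subgroup R G \<Longrightarrow> group_hom G (G Mod R) (\<lambda>c. R #> c)"
  by (simp add: group_hom_def group_hom_axioms_def comm_group.axioms(2)[OF abelian_FactGroup]
      normal.r_coset_hom_Mod[OF subgroup_imp_normal])

lemma comm_group_subquotient:
  assumes "subgroup K G" "subgroup R G"
  shows "comm_group ((G\<lparr>carrier := K\<rparr>) Mod R)"
proof -
  interpret Q: comm_group "G Mod R"
    by (rule abelian_FactGroup[OF assms(2)])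
  have sub: "subgroup ((\<lambda>c. R #> c) ` K) (G Mod R)"
    using group_hom.subgroup_img_is_subgroup[OF group_hom_r_coset[OF assms(2)] assms(1)] .
  show ?thesis
    unfolding subquotient_eq
    by (rule group.group_comm_groupI[OF subgroup.subgroup_is_group[OF sub Q.is_group]])
      (use Q.m_comm subgroup.mem_carrier[OF sub] in simp)
qed

lemma subquotient_pow:
  assumes "subgroup R G" "c \<in> carrier G"
  shows "(R #> c) [^]\<^bsub>(G\<lparr>carrier := K\<rparr>) Mod R\<^esub> (n::nat) = R #> (c [^] n)"
proof -
  interpret group_hom G "G Mod R" "\<lambda>c. R #> c"
    by (rule group_hom_r_coset[OF assms(1)])
  show ?thesis
    using hom_nat_pow[OF assms(2), of n] by (simp add: subquotient_eq nat_pow_def)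
qed

text \<open>The composite of \<open>f\<close> with the projection to \<open>G Mod S\<close> kills
  \<open>R\<close>, hence factors through \<open>G Mod R\<close>; the factor then restricts to the
  images of \<open>K\<close> and \<open>L\<close>. It is used for the identity and for the 12th
  power map.\<close>

lemma subquotient_hom:
  assumes "f \<in> hom G G" "subgroup R G" "subgroup S G" "f ` R \<subseteq> S"
    and "K \<subseteq> carrier G" "f ` K \<subseteq> L"
  obtains g where "g \<in> hom ((G\<lparr>carrier := K\<rparr>) Mod R) ((G\<lparr>carrier := L\<rparr>) Mod S)"
    and "\<And>c. c \<in> K \<Longrightarrow> g (R #> c) = S #> f c"
proof -
  interpret S: group_hom G "G Mod S" "\<lambda>c. S #> c"
    by (rule group_hom_r_coset[OF assms(3)])
  have "(\<lambda>c. S #> c) \<circ> f \<in> hom G (G Mod S)"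
    using assms(1) S.homh by (rule Group.hom_compose)
  then interpret F: group_hom G "G Mod S" "(\<lambda>c. S #> c) \<circ> f"
    by unfold_locales
  have "S #> f x = S" if "x \<in> R" for x
    using assms(2-4) that hom_in_carrier[OF assms(1)] subgroup.mem_carrier[OF assms(2)]
    by (intro coset_join2) auto
  then have "R \<subseteq> kernel G (G Mod S) ((\<lambda>c. S #> c) \<circ> f)"
    using subgroup.mem_carrier[OF assms(2)] by (auto simp: kernel_def)
  then obtain g where g: "g \<in> hom (G Mod R) (G Mod S)"
    "\<And>c. c \<in> carrier G \<Longrightarrow> g (R #> c) = S #> f c"
    using F.FactGroup_universal_kernel[OF subgroup_imp_normal[OF assms(2)]] by auto
  show thesis
  proof
    show "g \<in> hom ((G\<lparr>carrier := K\<rparr>) Mod R) ((G\<lparr>carrier := L\<rparr>) Mod S)"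
      unfolding subquotient_eq
    proof (rule homI)
      fix u assume "u \<in> carrier ((G Mod R)\<lparr>carrier := (\<lambda>c. R #> c) ` K\<rparr>)"
      then obtain c where "c \<in> K" "u = R #> c"
        by auto
      then show "g u \<in> carrier ((G Mod S)\<lparr>carrier := (\<lambda>c. S #> c) ` L\<rparr>)"
        using g(2)[OF subsetD[OF assms(5)]] assms(6) by auto
    next
      fix u v
      assume "u \<in> carrier ((G Mod R)\<lparr>carrier := (\<lambda>c. R #> c) ` K\<rparr>)"
        "v \<in> carrier ((G Mod R)\<lparr>carrier := (\<lambda>c. R #> c) ` K\<rparr>)"
      then have "u \<in> carrier (G Mod R)" "v \<in> carrier (G Mod R)"
        using assms(5) by (auto simp: carrier_FactGroup)
      then show "g (u \<otimes>\<^bsub>(G Mod R)\<lparr>carrier := (\<lambda>c. R #> c) ` K\<rparr>\<^esub> v) =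
          g u \<otimes>\<^bsub>(G Mod S)\<lparr>carrier := (\<lambda>c. S #> c) ` L\<rparr>\<^esub> g v"
        using hom_mult[OF g(1)] by simp
    qed
  qed (use g assms in auto)
qed

end

lemma torsion_kernel_cokernelI:
  assumes "comm_group G" "comm_group H" "h \<in> hom G H"
    and "m > 0" "\<And>x. x \<in> carrier G \<Longrightarrow> h x = \<one>\<^bsub>H\<^esub> \<Longrightarrow> x [^]\<^bsub>G\<^esub> (m::nat) = \<one>\<^bsub>G\<^esub>"
    and "n > 0" "\<And>y. y \<in> carrier H \<Longrightarrow> y [^]\<^bsub>H\<^esub> (n::nat) \<in> h ` carrier G"
  shows "torsion_kernel_cokernel G H h"
proof -
  interpret H: comm_group H by fact
  interpret h: group_hom G H h
    using assms by (simp add: group_hom_def group_hom_axioms_def comm_group.axioms(2))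
  let ?N = "h ` carrier G"
  interpret N: group_hom H "H Mod ?N" "\<lambda>y. ?N #>\<^bsub>H\<^esub> y"
    by (rule H.group_hom_r_coset[OF h.img_is_subgroup])
  have "torsion_group (G\<lparr>carrier := kernel G H h\<rparr>)"
    using assms(4,5) by (auto simp: torsion_group_def kernel_def nat_pow_def)
  \<comment> \<open>The power of a class is the class of the power, which is trivial because the
    power lies in the image \<open>?N\<close>.\<close>
  moreover have "(?N #>\<^bsub>H\<^esub> y) [^]\<^bsub>H Mod ?N\<^esub> n = \<one>\<^bsub>H Mod ?N\<^esub>" if "y \<in> carrier H" for y
    using N.hom_nat_pow[OF that, of n]
      H.coset_join2[OF H.nat_pow_closed[OF that] h.img_is_subgroup assms(7)[OF that]] by simp
  then have "torsion_group (H Mod ?N)"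
    unfolding torsion_group_def carrier_FactGroup using assms(6) by blast
  ultimately show ?thesis
    by (simp add: torsion_kernel_cokernel_def)
qed

section \<open>Tensor products\<close>

lemma hom_free_Abelian_group_eqI:
  assumes "group K" "f \<in> hom (free_Abelian_group S) K" "g \<in> hom (free_Abelian_group S) K"
    and "\<And>a. a \<in> S \<Longrightarrow> f (frag_of a) = g (frag_of a)"
    and "c \<in> carrier (free_Abelian_group S)"
  shows "f c = g c"
proof -
  let ?A = "free_Abelian_group S"
  interpret f: group_hom ?A K f
    using assms by (simp add: group_hom_def group_hom_axioms_def)
  interpret g: group_hom ?A K g
    using assms by (simp add: group_hom_def group_hom_axioms_def)
  \<comment> \<open>The induction over the free abelian group builds its elements by differences, so
    additivity is needed in this form.\<close>
  have diff: "h (c - d) = h c \<otimes>\<^bsub>K\<^esub> inv\<^bsub>K\<^esub> h d"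
    if "group_hom ?A K h" "Poly_Mapping.keys c \<subseteq> S" "Poly_Mapping.keys d \<subseteq> S" for h c d
  proof -
    interpret h: group_hom ?A K h by fact
    show ?thesis
      using h.hom_mult[of c "- d"] h.hom_inv[of d] that by simp
  qed
  have "Poly_Mapping.keys c \<subseteq> S"
    using assms(5) by simp
  then show ?thesis
    by (rule free_Abelian_group_induct)
      (use f.hom_one g.hom_one assms(4) in \<open>simp_all add: diff f.group_hom_axioms g.group_hom_axioms\<close>)
qed

section \<open>Bilinearity, universal property and functoriality of the tensor product\<close>

locale tensor_product =
  G: comm_group G + H: comm_group H for G :: "('a, 'm) monoid_scheme" and H :: "('b, 'n) monoid_scheme"
begin

abbreviation A where "A \<equiv> free_Abelian_group (carrier G \<times> carrier H)"
abbreviation rel where "rel \<equiv> tensor_rel G H"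
abbreviation pure where "pure \<equiv> pure_tensor G H"

sublocale A: comm_group A
  by (rule abelian_free_Abelian_group)

sublocale T: comm_group "tensor_group G H"
  by (rule comm_group_tensor_group[OF G.comm_group_axioms H.comm_group_axioms])

lemma free_diff: "c \<in> carrier A \<Longrightarrow> d \<in> carrier A \<Longrightarrow> c - d \<in> carrier A"
  using Poly_Mapping.keys_diff[of c d] by auto

lemma subgroup_tensor_rel: "subgroup rel A"
  unfolding tensor_rel_def
  by (intro A.generate_is_subgroup)
    (auto intro!: free_diff simp: frag_of_in_free_Abelian_group simp del: carrier_free_Abelian_group_iff)

sublocale coset: group_hom A "tensor_group G H" "\<lambda>c. rel #>\<^bsub>A\<^esub> c"
  unfolding tensor_group_def by (rule A.group_hom_r_coset[OF subgroup_tensor_rel])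

lemma pure_closed: "x \<in> carrier G \<Longrightarrow> y \<in> carrier H \<Longrightarrow> pure x y \<in> carrier (tensor_group G H)"
  unfolding pure_tensor_def by (rule coset.hom_closed) simp

text \<open>Write \<open>c\<close> as \<open>(c - d - e) + (d + e)\<close>; the first summand dies
  in the quotient. The shape \<open>c - d - e\<close> is that of the generators of
  \<open>tensor_rel\<close>, so both bilinearity laws become instances.\<close>

lemma coset_eq_mult:
  assumes "c - d - e \<in> rel" "c \<in> carrier A" "d \<in> carrier A" "e \<in> carrier A"
  shows "rel #>\<^bsub>A\<^esub> c = (rel #>\<^bsub>A\<^esub> d) \<otimes>\<^bsub>tensor_group G H\<^esub> (rel #>\<^bsub>A\<^esub> e)"
proof -
  have r: "c - d - e \<in> carrier A"
    by (intro free_diff assms)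
  have "rel #>\<^bsub>A\<^esub> c = rel #>\<^bsub>A\<^esub> ((c - d - e) \<otimes>\<^bsub>A\<^esub> (d \<otimes>\<^bsub>A\<^esub> e))"
    by (simp add: algebra_simps)
  also have "\<dots> = (rel #>\<^bsub>A\<^esub> (c - d - e)) \<otimes>\<^bsub>tensor_group G H\<^esub> (rel #>\<^bsub>A\<^esub> (d \<otimes>\<^bsub>A\<^esub> e))"
    using r assms A.m_closed by (intro coset.hom_mult) blast+
  also have "rel #>\<^bsub>A\<^esub> (c - d - e) = \<one>\<^bsub>tensor_group G H\<^esub>"
    using A.coset_join2[OF r subgroup_tensor_rel assms(1)] by (simp add: tensor_group_def)
  also have "rel #>\<^bsub>A\<^esub> (d \<otimes>\<^bsub>A\<^esub> e) = (rel #>\<^bsub>A\<^esub> d) \<otimes>\<^bsub>tensor_group G H\<^esub> (rel #>\<^bsub>A\<^esub> e)"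
    using assms by (intro coset.hom_mult) blast+
  finally show ?thesis
    using assms coset.hom_closed by simp
qed

lemma pure_mult_left:
  assumes "x \<in> carrier G" "x' \<in> carrier G" "y \<in> carrier H"
  shows "pure (x \<otimes>\<^bsub>G\<^esub> x') y = pure x y \<otimes>\<^bsub>tensor_group G H\<^esub> pure x' y"
  unfolding pure_tensor_def
  by (intro coset_eq_mult) (use assms in \<open>auto simp: tensor_rel_def intro!: generate.incl\<close>)

lemma pure_mult_right:
  assumes "x \<in> carrier G" "y \<in> carrier H" "y' \<in> carrier H"
  shows "pure x (y \<otimes>\<^bsub>H\<^esub> y') = pure x y \<otimes>\<^bsub>tensor_group G H\<^esub> pure x y'"
  unfolding pure_tensor_def
  by (intro coset_eq_mult) (use assms in \<open>auto simp: tensor_rel_def intro!: generate.incl\<close>)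

lemma pure_pow_left:
  assumes "x \<in> carrier G" "y \<in> carrier H"
  shows "pure (x [^]\<^bsub>G\<^esub> (n::nat)) y = pure x y [^]\<^bsub>tensor_group G H\<^esub> n"
proof -
  have "(\<lambda>x. pure x y) \<in> hom G (tensor_group G H)"
    using assms by (intro homI) (auto simp: pure_closed pure_mult_left)
  then show ?thesis
    by (rule hom_nat_pow) (use assms in simp_all)
qed

lemma pure_pow_right:
  assumes "x \<in> carrier G" "y \<in> carrier H"
  shows "pure x (y [^]\<^bsub>H\<^esub> (n::nat)) = pure x y [^]\<^bsub>tensor_group G H\<^esub> n"
proof -
  have "pure x \<in> hom H (tensor_group G H)"
    using assms by (intro homI) (auto simp: pure_closed pure_mult_right)
  then show ?thesis
    by (rule hom_nat_pow) (use assms in simp_all)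
qed

lemma hom_eqI:
  assumes "group K" "f \<in> hom (tensor_group G H) K" "g \<in> hom (tensor_group G H) K"
    and "\<And>x y. x \<in> carrier G \<Longrightarrow> y \<in> carrier H \<Longrightarrow> f (pure x y) = g (pure x y)"
    and "t \<in> carrier (tensor_group G H)"
  shows "f t = g t"
proof -
  obtain c where c: "c \<in> carrier A" "t = rel #>\<^bsub>A\<^esub> c"
    using assms(5) by (auto simp: tensor_group_def carrier_FactGroup)
  have "(f \<circ> (\<lambda>c. rel #>\<^bsub>A\<^esub> c)) c = (g \<circ> (\<lambda>c. rel #>\<^bsub>A\<^esub> c)) c"
    using assms(1) hom_compose[OF coset.homh assms(2)] hom_compose[OF coset.homh assms(3)] _ c(1)
    by (rule hom_free_Abelian_group_eqI) (use assms(4) in \<open>auto simp: pure_tensor_def\<close>)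
  then show ?thesis
    by (simp add: c(2))
qed

text \<open>The linear extension of \<open>b\<close> to the free abelian group on pairs kills every
  generator of \<open>tensor_rel\<close>, by bilinearity, and so factors through the
  quotient.\<close>

lemma bilinear_lift:
  assumes "comm_group K"
    and closed: "\<And>x y. x \<in> carrier G \<Longrightarrow> y \<in> carrier H \<Longrightarrow> b x y \<in> carrier K"
    and left: "\<And>x x' y. x \<in> carrier G \<Longrightarrow> x' \<in> carrier G \<Longrightarrow> y \<in> carrier H \<Longrightarrow>
      b (x \<otimes>\<^bsub>G\<^esub> x') y = b x y \<otimes>\<^bsub>K\<^esub> b x' y"
    and right: "\<And>x y y'. x \<in> carrier G \<Longrightarrow> y \<in> carrier H \<Longrightarrow> y' \<in> carrier H \<Longrightarrow>
      b x (y \<otimes>\<^bsub>H\<^esub> y') = b x y \<otimes>\<^bsub>K\<^esub> b x y'"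
  obtains h where "h \<in> hom (tensor_group G H) K"
    and "\<And>x y. x \<in> carrier G \<Longrightarrow> y \<in> carrier H \<Longrightarrow> h (pure x y) = b x y"
proof -
  interpret K: comm_group K by fact
  define f where "f = free_lift K (case_prod b)"
  have f: "f \<in> hom A K" "\<And>x y. x \<in> carrier G \<Longrightarrow> y \<in> carrier H \<Longrightarrow> f (frag_of (x, y)) = b x y"
    using free_lift_hom[OF assms(1), of "case_prod b" "carrier G \<times> carrier H"] closed
    unfolding f_def by (auto simp: Pi_iff)
  then interpret f: group_hom A K f
    by unfold_locales
  have f_diff: "f (c - d - e) = \<one>\<^bsub>K\<^esub>"
    if "f c = f d \<otimes>\<^bsub>K\<^esub> f e" "c \<in> carrier A" "d \<in> carrier A" "e \<in> carrier A" for c d e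
  proof -
    have cde: "c - d - e \<in> carrier A"
      by (intro free_diff that)
    have "f c = f ((c - d - e) \<otimes>\<^bsub>A\<^esub> (d \<otimes>\<^bsub>A\<^esub> e))"
      by (simp add: algebra_simps)
    also have "\<dots> = f (c - d - e) \<otimes>\<^bsub>K\<^esub> f (d \<otimes>\<^bsub>A\<^esub> e)"
      using cde that A.m_closed by (intro f.hom_mult) blast+
    also have "f (d \<otimes>\<^bsub>A\<^esub> e) = f c"
      using that f.hom_mult[of d e] by simp
    finally show ?thesis
      using K.l_cancel_one'[of "f c" "f (c - d - e)"] f.hom_closed cde that(2) by auto
  qed
  have "rel \<subseteq> kernel A K f"
    unfolding tensor_rel_def
    using f(2) left right
    by (intro A.generate_subgroup_incl f.subgroup_kernel)
      (auto simp: kernel_def simp del: carrier_free_Abelian_group_iff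
        intro!: f_diff free_diff frag_of_in_free_Abelian_group[THEN iffD2])
  then obtain h where "h \<in> hom (tensor_group G H) K" "\<And>c. c \<in> carrier A \<Longrightarrow> h (rel #>\<^bsub>A\<^esub> c) = f c"
    unfolding tensor_group_def
    using f.FactGroup_universal_kernel[OF A.subgroup_imp_normal[OF subgroup_tensor_rel]] by metis
  then show thesis
    using f(2) by (intro that[of h]) (auto simp: pure_tensor_def)
qed

end

lemma tensor_map:
  assumes "comm_group G" "comm_group H" "comm_group G'" "comm_group H'"
    and "f \<in> hom G G'" "g \<in> hom H H'"
  obtains h where "h \<in> hom (tensor_group G H) (tensor_group G' H')"
    and "\<And>x y. x \<in> carrier G \<Longrightarrow> y \<in> carrier H \<Longrightarrow>
      h (pure_tensor G H x y) = pure_tensor G' H' (f x) (g y)"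
proof -
  interpret T: tensor_product G H using assms by (simp add: tensor_product_def)
  interpret T': tensor_product G' H' using assms by (simp add: tensor_product_def)
  show thesis
    using T.bilinear_lift[OF T'.T.comm_group_axioms, of "\<lambda>x y. pure_tensor G' H' (f x) (g y)"] that
      hom_in_carrier[OF assms(5)] hom_in_carrier[OF assms(6)] hom_mult[OF assms(5)] hom_mult[OF assms(6)]
    by (auto simp: T'.pure_closed T'.pure_mult_left T'.pure_mult_right)
qed

text \<open>The maps are induced by \<open>f\<close> and the identity in one direction, and by
  \<open>g\<close> and \<open>d\<close> in the other. In additive notation each composite sends a
  pure tensor of \<open>x\<close> and \<open>q\<close> to that of \<open>n x\<close> and
  \<open>d q\<close>; moving \<open>n\<close> to the right factor gives \<open>x\<close> and
  \<open>n (d q) = q\<close>. Division by \<open>n\<close> in \<open>H\<close> thus undoes the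
  multiplication by \<open>n\<close>.\<close>

lemma tensor_iso_of_mutual_power:
  assumes "comm_group G" "comm_group G'" "comm_group H"
    and f: "f \<in> hom G G'" and g: "g \<in> hom G' G"
    and gf: "\<And>x. x \<in> carrier G \<Longrightarrow> g (f x) = x [^]\<^bsub>G\<^esub> (n::nat)"
    and fg: "\<And>x. x \<in> carrier G' \<Longrightarrow> f (g x) = x [^]\<^bsub>G'\<^esub> n"
    and d: "d \<in> hom H H" "\<And>q. q \<in> carrier H \<Longrightarrow> d q [^]\<^bsub>H\<^esub> n = q"
  shows "tensor_group G H \<cong> tensor_group G' H"
proof -
  interpret T: tensor_product G H using assms by (simp add: tensor_product_def)
  interpret T': tensor_product G' H using assms by (simp add: tensor_product_def)
  obtain F where F: "F \<in> hom (tensor_group G H) (tensor_group G' H)"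
    "\<And>x y. x \<in> carrier G \<Longrightarrow> y \<in> carrier H \<Longrightarrow> F (T.pure x y) = T'.pure (f x) y"
    using tensor_map[OF assms(1,3,2,3) f, of id] by (auto simp: hom_def)
  obtain D where D: "D \<in> hom (tensor_group G' H) (tensor_group G H)"
    "\<And>x y. x \<in> carrier G' \<Longrightarrow> y \<in> carrier H \<Longrightarrow> D (T'.pure x y) = T.pure (g x) (d y)"
    using tensor_map[OF assms(2,3,1,3) g d(1)] by blast
  note closed = hom_in_carrier[OF f] hom_in_carrier[OF g] hom_in_carrier[OF d(1)]
  have "(D \<circ> F) t = id t" if "t \<in> carrier (tensor_group G H)" for t
    using T.T.is_group hom_compose[OF F(1) D(1)] _ _ that
  proof (rule T.hom_eqI)
    fix x y assume xy: "x \<in> carrier G" "y \<in> carrier H"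
    have "(D \<circ> F) (T.pure x y) = T.pure x (d y) [^]\<^bsub>tensor_group G H\<^esub> n"
      using xy by (simp add: F(2) D(2) closed gf T.pure_pow_left)
    also have "\<dots> = T.pure x y"
      using T.pure_pow_right[OF xy(1) closed(3)[OF xy(2)], of n] by (simp add: d(2)[OF xy(2)])
    finally show "(D \<circ> F) (T.pure x y) = id (T.pure x y)"
      by simp
  qed (auto simp: hom_def)
  moreover have "(F \<circ> D) t = id t" if "t \<in> carrier (tensor_group G' H)" for t
    using T'.T.is_group hom_compose[OF D(1) F(1)] _ _ that
  proof (rule T'.hom_eqI)
    fix x y assume xy: "x \<in> carrier G'" "y \<in> carrier H"
    have "(F \<circ> D) (T'.pure x y) = T'.pure x (d y) [^]\<^bsub>tensor_group G' H\<^esub> n"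
      using xy by (simp add: F(2) D(2) closed fg T'.pure_pow_left)
    also have "\<dots> = T'.pure x y"
      using T'.pure_pow_right[OF xy(1) closed(3)[OF xy(2)], of n] by (simp add: d(2)[OF xy(2)])
    finally show "(F \<circ> D) (T'.pure x y) = id (T'.pure x y)"
      by simp
  qed (auto simp: hom_def)
  ultimately have "group_isomorphisms (tensor_group G H) (tensor_group G' H) F D"
    using F(1) D(1) by (simp add: group_isomorphisms_def)
  then show ?thesis
    unfolding is_iso_def using group_isomorphisms_imp_iso by blast
qed

section \<open>Division by 12 in \<open>Z_inv6\<close>\<close>

lemma Z_inv6_pow: "q [^]\<^bsub>Z_inv6\<^esub> (n::nat) = of_nat n * q"
  by (induction n) (simp_all add: Z_inv6_def nat_pow_def algebra_simps)

lemma Z_inv6_div12_hom: "(\<lambda>q. q / 12) \<in> hom Z_inv6 Z_inv6"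
proof (rule homI)
  fix q assume "q \<in> carrier Z_inv6"
  then obtain k n where "q = of_int k / 6 ^ n"
    by (auto simp: Z_inv6_def)
  \<comment> \<open>Since 1/12 = 3/36, the exponent of 6 rises by two.\<close>
  then have "q / 12 = of_int (3 * k) / 6 ^ (n + 2)"
    by simp
  then have "\<exists>k n. q / 12 = of_int k / 6 ^ n"
    by blast
  then show "q / 12 \<in> carrier Z_inv6"
    unfolding Z_inv6_def by simp
qed (simp add: Z_inv6_def add_divide_distrib)

section \<open>Relations between symbols\<close>

lemma comm_group_ZF: "comm_group ZF"
  unfolding ZF_def by (rule abelian_free_Abelian_group)

lemma carrier_ZF_iff [simp]: "c \<in> carrier ZF \<longleftrightarrow> Poly_Mapping.keys c \<subseteq> UNIV - {0, 1}"
  by (simp add: ZF_def)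

lemma mult_ZF [simp]: "c \<otimes>\<^bsub>ZF\<^esub> d = c + d"
  by (simp add: ZF_def)

lemma one_ZF [simp]: "\<one>\<^bsub>ZF\<^esub> = 0"
  by (simp add: ZF_def)

lemma inv_ZF: "c \<in> carrier ZF \<Longrightarrow> inv\<^bsub>ZF\<^esub> c = - c"
  by (simp add: ZF_def)

lemma nat_pow_ZF: "c [^]\<^bsub>ZF\<^esub> (n::nat) = frag_cmul (int n) c"
  by (simp add: ZF_def)

lemma ZF_add: "c \<in> carrier ZF \<Longrightarrow> d \<in> carrier ZF \<Longrightarrow> c + d \<in> carrier ZF"
  using Poly_Mapping.keys_add[of c d] by auto

lemma ZF_diff: "c \<in> carrier ZF \<Longrightarrow> d \<in> carrier ZF \<Longrightarrow> c - d \<in> carrier ZF"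
  using Poly_Mapping.keys_diff[of c d] by auto

lemma ZF_frag_of: "a \<notin> {0, 1} \<Longrightarrow> frag_of a \<in> carrier ZF"
  by simp

lemma subgroup_ZF_closed:
  assumes "subgroup R ZF"
  shows "0 \<in> R" and "\<And>c d. c \<in> R \<Longrightarrow> d \<in> R \<Longrightarrow> c + d \<in> R"
    and "\<And>c d. c \<in> R \<Longrightarrow> d \<in> R \<Longrightarrow> c - d \<in> R"
proof -
  interpret R: subgroup R ZF by fact
  show "0 \<in> R"
    using R.one_closed by simp
  show add: "c + d \<in> R" if "c \<in> R" "d \<in> R" for c d
    using R.m_closed[OF that] by simp
  show "c - d \<in> R" if "c \<in> R" "d \<in> R" for c d
    using add[OF that(1) R.m_inv_closed[OF that(2)]] inv_ZF[OF R.mem_carrier[OF that(2)]] by simp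
qed

section \<open>Formal identities between the defining relations\<close>

definition inv_pair :: "'f::field \<Rightarrow> ('f \<Rightarrow>\<^sub>0 int)" where
  "inv_pair x = frag_of x + frag_of (inverse x)"

definition compl_pair :: "'f::field \<Rightarrow> ('f \<Rightarrow>\<^sub>0 int)" where
  "compl_pair x = frag_of x + frag_of (1 - x)"

definition five_term :: "'f::field \<Rightarrow> 'f \<Rightarrow> ('f \<Rightarrow>\<^sub>0 int)" where
  "five_term a b = frag_of a + frag_of b + frag_of ((1 - a) / (1 - a * b)) + frag_of (1 - a * b)
     + frag_of ((1 - b) / (1 - a * b))"

definition suslin_five_term :: "'f::field \<Rightarrow> 'f \<Rightarrow> ('f \<Rightarrow>\<^sub>0 int)" where
  "suslin_five_term x y = frag_of x - frag_of y + frag_of (y / x)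
     - frag_of ((1 - inverse x) / (1 - inverse y)) + frag_of ((1 - x) / (1 - y))"

lemma inv_pair_inverse: "inv_pair (inverse x) = inv_pair x"
  by (simp add: inv_pair_def add.commute)

text \<open>The arguments \<open>x\<close>, \<open>1/y\<close>, \<open>1/(1 - 1/v)\<close>,
  \<open>1 - x/y\<close>, \<open>1/(1 - u)\<close> of the five-term element are matched with the
  arguments \<open>x\<close>, \<open>y\<close>, \<open>v\<close>, \<open>y/x\<close>,
  \<open>u\<close> of Suslin's. The first pair agrees, and each other pair is linked by maps
  \<open>a \<mapsto> 1 - a\<close> and \<open>a \<mapsto> 1/a\<close>; each of the four summands on
  the right records the correction for one pair.\<close>

lemma five_term_diff_suslin_five_term:
  fixes x y :: "'f::field"
  assumes "x \<notin> {0, 1}" "y \<notin> {0, 1}" "x \<noteq> y"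
  defines "u \<equiv> (1 - x) / (1 - y)"
  defines "v \<equiv> (1 - inverse x) / (1 - inverse y)"
  shows "five_term x (inverse y) - suslin_five_term x y =
    inv_pair y + (compl_pair (x / y) - inv_pair (x / y))
      + (inv_pair (1 - inverse v) - compl_pair (inverse v) + inv_pair v)
      + (inv_pair (1 - u) - compl_pair u)"
proof -
  have xy: "x \<noteq> 0" "x \<noteq> 1" "y \<noteq> 0" "y \<noteq> 1" "1 - y \<noteq> 0" "1 - x \<noteq> 0" "y - x \<noteq> 0" "x - y \<noteq> 0"
    using assms by auto
  have v: "1 - inverse v = (x - y) / (y * (x - 1))"
    using xy unfolding v_def by (simp add: field_simps)
  have 1: "(1 - x) / (1 - x * inverse y) = inverse (1 - inverse v)"
    unfolding v using xy by (simp add: divide_simps) (simp add: algebra_simps)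
  have u: "1 - u = (x - y) / (1 - y)"
    using xy unfolding u_def by (simp add: field_simps)
  have 2: "(1 - inverse y) / (1 - x * inverse y) = inverse (1 - u)"
    unfolding u using xy by (simp add: divide_simps) (simp add: algebra_simps)
  have 3: "y / x = inverse (x / y)" "x * inverse y = x / y"
    by (simp_all add: field_simps)
  show ?thesis
    unfolding five_term_def suslin_five_term_def 1 2 u_def[symmetric] v_def[symmetric]
    unfolding 3 inv_pair_def compl_pair_def by (simp add: algebra_simps)
qed

text \<open>Exchanging \<open>x\<close> and \<open>y\<close> cancels the first two terms and inverts
  the arguments of the other three.\<close>

lemma suslin_five_term_swap:
  "suslin_five_term x y + suslin_five_term y x =
     inv_pair (y / x) - inv_pair ((1 - inverse x) / (1 - inverse y)) + inv_pair ((1 - x) / (1 - y))"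
  by (simp add: suslin_five_term_def inv_pair_def algebra_simps)

text \<open>Replacing \<open>(x, y)\<close> by \<open>(1 - y, 1 - x)\<close> exchanges the third and
  fifth arguments and fixes the fourth, so only the first two terms of each element survive in the
  difference.\<close>

lemma suslin_five_term_compl:
  fixes x y :: "'f::field"
  assumes "x \<notin> {0, 1}" "y \<notin> {0, 1}" "x \<noteq> y"
  shows "suslin_five_term x y - suslin_five_term (1 - y) (1 - x) = compl_pair x - compl_pair y"
proof -
  have "1 - y \<noteq> 0" "1 - x \<noteq> 0" "x - 1 \<noteq> 0" "y - 1 \<noteq> 0" "x \<noteq> 0" "y \<noteq> 0"
    using assms by auto
  then have "(1 - inverse (1 - y)) / (1 - inverse (1 - x)) = (1 - inverse x) / (1 - inverse y)"
    by (simp add: divide_simps) (simp add: algebra_simps)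
  then show ?thesis
    by (simp add: suslin_five_term_def compl_pair_def algebra_simps)
qed

text \<open>Both sides are the formal sum of the six anharmonic transforms of \<open>x\<close>,
  paired by \<open>a \<mapsto> 1 - a\<close> on the left and by \<open>a \<mapsto> 1/a\<close> on
  the right.\<close>

lemma sum_compl_pair_anharmonic:
  fixes x :: "'f::field"
  assumes "x \<notin> {0, 1}"
  shows "compl_pair x + compl_pair (inverse x) + compl_pair (inverse (1 - x)) =
    inv_pair x + inv_pair (1 - x) + inv_pair (1 - inverse x)"
proof -
  have "x \<noteq> 0" "1 - x \<noteq> 0" "x - 1 \<noteq> 0"
    using assms by auto
  then have eq: "1 - inverse (1 - x) = inverse (1 - inverse x)"
    by (simp add: divide_simps) (simp add: algebra_simps)
  show ?thesis
    unfolding inv_pair_def compl_pair_def eq by (simp add: ac_simps)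
qed

section \<open>Generators and membership for the two groups of relations\<close>

lemma suslin_rel_eq:
  "suslin_rel = generate ZF {suslin_five_term x y | x y. x \<notin> {0, 1} \<and> y \<notin> {0, 1} \<and> x \<noteq> y}"
  unfolding suslin_rel_def suslin_five_term_def ..

lemma bloch_rel_eq:
  "bloch_rel = generate ZF ({compl_pair a | a. a \<notin> {0, 1}} \<union> {inv_pair a | a. a \<notin> {0, 1}} \<union>
     {five_term a b | a b. a \<notin> {0, 1} \<and> b \<notin> {0, 1} \<and> a * b \<noteq> 1})"
  unfolding bloch_rel_def compl_pair_def inv_pair_def five_term_def ..

lemma inv_pair_in_ZF: "x \<notin> {0, 1} \<Longrightarrow> inv_pair x \<in> carrier ZF"
  unfolding inv_pair_def by (intro ZF_add ZF_frag_of) auto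

lemma compl_pair_in_ZF: "x \<notin> {0, 1} \<Longrightarrow> compl_pair x \<in> carrier ZF"
  unfolding compl_pair_def by (intro ZF_add ZF_frag_of) auto

lemma five_term_in_ZF:
  "a \<notin> {0, 1} \<Longrightarrow> b \<notin> {0, 1} \<Longrightarrow> a * b \<noteq> 1 \<Longrightarrow> five_term a b \<in> carrier ZF"
  unfolding five_term_def by (intro ZF_add ZF_frag_of) (auto simp: field_simps)

lemma suslin_five_term_in_ZF:
  "x \<notin> {0, 1} \<Longrightarrow> y \<notin> {0, 1} \<Longrightarrow> x \<noteq> y \<Longrightarrow> suslin_five_term x y \<in> carrier ZF"
  unfolding suslin_five_term_def
  by (intro ZF_add ZF_diff ZF_frag_of) (auto simp: field_simps)

lemma subgroup_bloch_rel: "subgroup bloch_rel ZF"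
proof -
  interpret ZF: comm_group ZF by (rule comm_group_ZF)
  show ?thesis
    unfolding bloch_rel_eq
    by (intro ZF.generate_is_subgroup)
      (auto intro!: five_term_in_ZF inv_pair_in_ZF compl_pair_in_ZF simp del: carrier_ZF_iff)
qed

lemma subgroup_suslin_rel: "subgroup suslin_rel ZF"
proof -
  interpret ZF: comm_group ZF by (rule comm_group_ZF)
  show ?thesis
    unfolding suslin_rel_eq
    by (intro ZF.generate_is_subgroup)
      (auto intro!: suslin_five_term_in_ZF simp del: carrier_ZF_iff)
qed

lemmas bloch_rel_closed = subgroup_ZF_closed[OF subgroup_bloch_rel]
lemmas suslin_rel_closed = subgroup_ZF_closed[OF subgroup_suslin_rel]

lemma inv_pair_in_bloch_rel: "a \<notin> {0, 1} \<Longrightarrow> inv_pair a \<in> bloch_rel"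
  unfolding bloch_rel_eq by (rule generate.incl) blast

lemma compl_pair_in_bloch_rel: "a \<notin> {0, 1} \<Longrightarrow> compl_pair a \<in> bloch_rel"
  unfolding bloch_rel_eq by (rule generate.incl) blast

lemma five_term_in_bloch_rel:
  "a \<notin> {0, 1} \<Longrightarrow> b \<notin> {0, 1} \<Longrightarrow> a * b \<noteq> 1 \<Longrightarrow> five_term a b \<in> bloch_rel"
  unfolding bloch_rel_eq by (rule generate.incl) blast

lemma suslin_five_term_in_suslin_rel:
  "x \<notin> {0, 1} \<Longrightarrow> y \<notin> {0, 1} \<Longrightarrow> x \<noteq> y \<Longrightarrow> suslin_five_term x y \<in> suslin_rel"
  unfolding suslin_rel_eq by (rule generate.incl) blast

lemma suslin_ratios:
  fixes x y :: "'f::field"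
  assumes "x \<notin> {0, 1}" "y \<notin> {0, 1}" "x \<noteq> y"
  shows "x / y \<notin> {0, 1}" "(1 - x) / (1 - y) \<notin> {0, 1}"
    "(1 - inverse x) / (1 - inverse y) \<notin> {0, 1}"
  using assms by (auto simp: field_simps)

section \<open>Suslin's relations hold in the first version\<close>

lemma suslin_rel_subset_bloch_rel: "(suslin_rel :: ('f::field \<Rightarrow>\<^sub>0 int) set) \<subseteq> bloch_rel"
proof -
  interpret ZF: comm_group "ZF :: ('f \<Rightarrow>\<^sub>0 int) monoid" by (rule comm_group_ZF)
  have "suslin_five_term x y \<in> bloch_rel" if "x \<notin> {0, 1}" "y \<notin> {0, 1}" "x \<noteq> y" for x y :: 'f
  proof -
    define u where "u = (1 - x) / (1 - y)"
    define v where "v = (1 - inverse x) / (1 - inverse y)"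
    have uv: "u \<notin> {0, 1}" "v \<notin> {0, 1}" "x / y \<notin> {0, 1}"
      using suslin_ratios[OF that] unfolding u_def v_def by blast+
    then have *: "inverse v \<notin> {0, 1}" "1 - u \<notin> {0, 1}" "1 - inverse v \<notin> {0, 1}"
      by auto
    have "suslin_five_term x y = five_term x (inverse y) -
      (inv_pair y + (compl_pair (x / y) - inv_pair (x / y))
        + (inv_pair (1 - inverse v) - compl_pair (inverse v) + inv_pair v)
        + (inv_pair (1 - u) - compl_pair u))"
      using five_term_diff_suslin_five_term[OF that]
      unfolding u_def v_def by (simp add: algebra_simps)
    also have "\<dots> \<in> bloch_rel"
      using that
      by (intro bloch_rel_closed inv_pair_in_bloch_rel compl_pair_in_bloch_rel
            five_term_in_bloch_rel uv *) (auto simp: field_simps)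
    finally show ?thesis .
  qed
  then show ?thesis
    unfolding suslin_rel_eq by (intro ZF.generate_subgroup_incl subgroup_bloch_rel) blast
qed

section \<open>Six times the relations of the first version lie in \<open>suslin_rel\<close>\<close>

lemma inv_pair_mult:
  fixes p u :: "'f::field"
  assumes "p \<notin> {0, 1}" "u \<notin> {0, 1}" "p * u \<noteq> 1"
  shows "inv_pair p + inv_pair u - inv_pair (p * u) \<in> suslin_rel"
proof -
  \<comment> \<open>The solution of \<open>y / x = p\<close> and
    \<open>(1 - x) / (1 - y) = u\<close>; the denominator is nonzero because
    \<open>p * u \<noteq> 1\<close>.\<close>
  define x where "x = (u - 1) / (u * p - 1)"
  define y where "y = p * x"
  have nz: "u * p - 1 \<noteq> 0" "p \<noteq> 0" "u \<noteq> 0" "u - 1 \<noteq> 0" "p - 1 \<noteq> 0"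
    using assms by (auto simp: mult.commute)
  have x: "x \<notin> {0, 1}"
    using nz by (auto simp: x_def field_simps)
  have y: "y \<notin> {0, 1}"
    using nz by (auto simp: y_def x_def field_simps)
  have xy: "x \<noteq> y"
    using x assms by (auto simp: y_def)
  have p: "y / x = p"
    using x by (auto simp: y_def)
  have "1 - x = u * (1 - y)"
    using nz unfolding y_def x_def by (simp add: divide_simps) (simp add: algebra_simps)
  then have u: "(1 - x) / (1 - y) = u"
    using y by simp
  \<comment> \<open>In Suslin's relation the fourth argument is the product of the third and the
    fifth. Adding the relation with \<open>x\<close> and \<open>y\<close> exchanged therefore
    compares \<open>inv_pair\<close> at \<open>p\<close>, \<open>u\<close> and
    \<open>p * u\<close>.\<close>
  have "(1 - inverse x) / (1 - inverse y) = (y / x) * ((1 - x) / (1 - y))"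
    using x y by (simp add: divide_simps) (auto simp: algebra_simps)
  then have pu: "(1 - inverse x) / (1 - inverse y) = p * u"
    by (simp add: p u)
  have "suslin_five_term x y + suslin_five_term y x \<in> suslin_rel"
    using x y xy by (intro suslin_rel_closed suslin_five_term_in_suslin_rel) auto
  then show ?thesis
    unfolding suslin_five_term_swap p u pu by (simp add: algebra_simps)
qed

text \<open>Comparing the four products of \<open>x y\<close> and \<open>x / y\<close> for an auxiliary \<open>x\<close> gives
  \<open>2 \<langle>x\<rangle> = \<langle>x\<^sup>2\<rangle> = 2 \<langle>x\<rangle> + 2 \<langle>y\<rangle>\<close>.\<close>

lemma double_inv_pair:
  fixes y :: "'f::field_char_0"
  assumes "y \<notin> {0, 1}"
  shows "inv_pair y + inv_pair y \<in> suslin_rel"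
proof -
  \<comment> \<open>A field of characteristic 0 is infinite, so \<open>x\<close> can avoid the
    finitely many values for which one of \<open>x\<close>, \<open>x * x\<close>,
    \<open>x * y\<close>, \<open>x / y\<close> is 0 or 1.\<close>
  obtain x where x: "x \<notin> {0, 1, -1, y, inverse y}"
    using ex_new_if_finite[OF infinite_UNIV_char_0, of "{0, 1, -1, y, inverse y}"] by auto
  then have x': "x \<noteq> 0" "x \<noteq> 1" "x \<noteq> -1" "x \<noteq> y" "x \<noteq> inverse y"
    by auto
  have y: "y \<noteq> 0" "y \<noteq> 1"
    using assms by auto
  have xx: "x * x \<noteq> 1"
    using x' by (simp add: square_eq_1_iff)
  have xy: "x * y \<noteq> 1"
    using x' y by (auto simp: field_simps)
  have xiy: "x * inverse y \<noteq> 1"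
    using x' y by (auto simp: field_simps)
  have prod: "(x * y) * (x * inverse y) = x * x"
    using y by simp
  have xx': "(x * y) * (x * inverse y) \<noteq> 1"
    unfolding prod by (rule xx)
  have rels: "inv_pair x + inv_pair y - inv_pair (x * y) \<in> suslin_rel"
    "inv_pair x + inv_pair (inverse y) - inv_pair (x * inverse y) \<in> suslin_rel"
    "inv_pair (x * y) + inv_pair (x * inverse y) - inv_pair ((x * y) * (x * inverse y))
       \<in> suslin_rel"
    "inv_pair x + inv_pair x - inv_pair (x * x) \<in> suslin_rel"
    by (rule inv_pair_mult; use x' y xx xx' xy xiy in auto)+
  have "inv_pair y + inv_pair y =
    (inv_pair x + inv_pair y - inv_pair (x * y))
    + (inv_pair x + inv_pair (inverse y) - inv_pair (x * inverse y))
    + (inv_pair (x * y) + inv_pair (x * inverse y) - inv_pair ((x * y) * (x * inverse y)))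
    - (inv_pair x + inv_pair x - inv_pair (x * x))"
    unfolding prod inv_pair_inverse by (simp add: algebra_simps)
  also have "\<dots> \<in> suslin_rel"
    by (intro suslin_rel_closed rels)
  finally show ?thesis .
qed

lemma compl_pair_diff:
  fixes x y :: "'f::field"
  assumes "x \<notin> {0, 1}" "y \<notin> {0, 1}"
  shows "compl_pair x - compl_pair y \<in> suslin_rel"
proof (cases "x = y")
  case True
  then show ?thesis
    using suslin_rel_closed by simp
next
  case False
  have "suslin_five_term x y - suslin_five_term (1 - y) (1 - x) \<in> suslin_rel"
    using assms False by (intro suslin_rel_closed suslin_five_term_in_suslin_rel) auto
  then show ?thesis
    by (simp add: suslin_five_term_compl[OF assms False])
qed

lemma frag_cmul_diff_distrib2: "frag_cmul k (c - d) = frag_cmul k c - frag_cmul k d"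
  by (rule poly_mapping_eqI) (simp add: lookup_minus algebra_simps)

lemma frag_cmul_suslin_rel: "c \<in> suslin_rel \<Longrightarrow> frag_cmul (int n) c \<in> suslin_rel"
  using group.subgroup_nat_pow_closed[OF comm_group.axioms(2)[OF comm_group_ZF] subgroup_suslin_rel]
  by (simp add: nat_pow_ZF)

text \<open>Twice an \<open>inv_pair\<close> is already a relation; the factor 6 matches the
  exponent used for \<open>compl_pair\<close>.\<close>

lemma six_inv_pair:
  fixes y :: "'f::field_char_0"
  assumes "y \<notin> {0, 1}"
  shows "frag_cmul 6 (inv_pair y) \<in> suslin_rel"
proof -
  have "frag_cmul 6 (inv_pair y) = frag_cmul (int 3) (inv_pair y + inv_pair y)"
    unfolding frag_cmul_distrib2 frag_cmul_distrib[symmetric] by simp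
  then show ?thesis
    using frag_cmul_suslin_rel[OF double_inv_pair[OF assms], of 3] by simp
qed

lemma six_compl_pair:
  fixes x :: "'f::field_char_0"
  assumes "x \<notin> {0, 1}"
  shows "frag_cmul 6 (compl_pair x) \<in> suslin_rel"
proof -
  let ?d = "\<lambda>y. compl_pair x - compl_pair y"
  let ?s = "inv_pair x + inv_pair (1 - x) + inv_pair (1 - inverse x)"
  have "frag_cmul 3 (compl_pair x) = frag_cmul (1 + 1 + 1) (compl_pair x)"
    by simp
  \<comment> \<open>Modulo \<open>suslin_rel\<close> all values of \<open>compl_pair\<close> agree:
    replacing those at \<open>1/x\<close> and \<open>1/(1 - x)\<close> by
    \<open>compl_pair x\<close> in the anharmonic sum costs only the corrections
    \<open>?d\<close>.\<close>
  also have "\<dots> = ?s + ?d (inverse x) + ?d (inverse (1 - x))"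
    unfolding frag_cmul_distrib
    using sum_compl_pair_anharmonic[OF assms] by (simp add: algebra_simps)
  finally have 3: "frag_cmul 3 (compl_pair x) = ?s + ?d (inverse x) + ?d (inverse (1 - x))" .
  have "frag_cmul 6 (compl_pair x) = frag_cmul (3 + 3) (compl_pair x)"
    by simp
  also have "\<dots> = ((inv_pair x + inv_pair x) + (inv_pair (1 - x) + inv_pair (1 - x))
      + (inv_pair (1 - inverse x) + inv_pair (1 - inverse x)))
      + (?d (inverse x) + ?d (inverse x)) + (?d (inverse (1 - x)) + ?d (inverse (1 - x)))"
    unfolding frag_cmul_distrib 3 by (simp add: algebra_simps)
  also have "\<dots> \<in> suslin_rel"
    using assms by (intro suslin_rel_closed double_inv_pair compl_pair_diff) auto
  finally show ?thesis .
qed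

text \<open>Up to values of \<open>inv_pair\<close> and \<open>compl_pair\<close>, all killed by 6,
  \<open>five_term a b\<close> is Suslin's element at \<open>(a, 1/b)\<close>; the condition
  \<open>a * b \<noteq> 1\<close> says that these two arguments differ.\<close>

lemma six_five_term:
  fixes a b :: "'f::field_char_0"
  assumes "a \<notin> {0, 1}" "b \<notin> {0, 1}" "a * b \<noteq> 1"
  shows "frag_cmul 6 (five_term a b) \<in> suslin_rel"
proof -
  define y where "y = inverse b"
  define u where "u = (1 - a) / (1 - y)"
  define v where "v = (1 - inverse a) / (1 - inverse y)"
  have y: "y \<notin> {0, 1}" "a \<noteq> y" "inverse y = b"
    using assms by (auto simp: y_def)
  have uv: "u \<notin> {0, 1}" "v \<notin> {0, 1}" "a / y \<notin> {0, 1}"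
    using suslin_ratios[OF assms(1) y(1,2)] unfolding u_def v_def by blast+
  then have *: "inverse v \<notin> {0, 1}" "1 - u \<notin> {0, 1}" "1 - inverse v \<notin> {0, 1}"
    by auto
  have "five_term a b = suslin_five_term a y +
      (inv_pair y + (compl_pair (a / y) - inv_pair (a / y))
        + (inv_pair (1 - inverse v) - compl_pair (inverse v) + inv_pair v)
        + (inv_pair (1 - u) - compl_pair u))"
    using five_term_diff_suslin_five_term[OF assms(1) y(1,2)]
    unfolding u_def v_def y(3) by (simp add: algebra_simps)
  then have "frag_cmul 6 (five_term a b) = frag_cmul 6 (suslin_five_term a y)
      + (frag_cmul 6 (inv_pair y)
        + (frag_cmul 6 (compl_pair (a / y)) - frag_cmul 6 (inv_pair (a / y)))
        + (frag_cmul 6 (inv_pair (1 - inverse v)) - frag_cmul 6 (compl_pair (inverse v))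
          + frag_cmul 6 (inv_pair v))
        + (frag_cmul 6 (inv_pair (1 - u)) - frag_cmul 6 (compl_pair u)))"
    by (simp add: frag_cmul_distrib2 frag_cmul_diff_distrib2)
  also have "\<dots> \<in> suslin_rel"
    using frag_cmul_suslin_rel[OF suslin_five_term_in_suslin_rel[OF assms(1) y(1,2)], of 6]
    by (intro suslin_rel_closed six_inv_pair six_compl_pair uv * y(1)) simp
  finally show ?thesis .
qed

lemma six_bloch_rel:
  fixes c :: "'f::field_char_0 \<Rightarrow>\<^sub>0 int"
  assumes "c \<in> bloch_rel"
  shows "frag_cmul 6 c \<in> suslin_rel"
proof -
  interpret ZF: comm_group "ZF :: ('f \<Rightarrow>\<^sub>0 int) monoid" by (rule comm_group_ZF)
  have "c [^]\<^bsub>ZF\<^esub> (6::nat) \<in> suslin_rel"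
    using assms unfolding bloch_rel_eq
    by (rule ZF.generate_nat_pow_subset[OF subgroup_suslin_rel, rotated -1])
      (auto simp: nat_pow_ZF simp del: carrier_ZF_iff
        intro!: six_inv_pair six_compl_pair six_five_term
          five_term_in_ZF inv_pair_in_ZF compl_pair_in_ZF)
  then show ?thesis
    by (simp add: nat_pow_ZF)
qed

section \<open>The two boundary maps\<close>

interpretation units: tensor_product "units_group :: 'f::field monoid" "units_group :: 'f monoid"
  by (simp add: tensor_product_def comm_group_units_group)

lemma ptensor_mult_left:
  "x \<noteq> 0 \<Longrightarrow> x' \<noteq> 0 \<Longrightarrow> y \<noteq> 0 \<Longrightarrow> ptensor (x * x') y = ptensor x y \<otimes>\<^bsub>FxF\<^esub> ptensor x' y"
  using units.pure_mult_left[of x x' y] by (simp add: units_group_def)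

lemma ptensor_mult_right:
  "x \<noteq> 0 \<Longrightarrow> y \<noteq> 0 \<Longrightarrow> y' \<noteq> 0 \<Longrightarrow> ptensor x (y * y') = ptensor x y \<otimes>\<^bsub>FxF\<^esub> ptensor x y'"
  using units.pure_mult_right[of x y y'] by (simp add: units_group_def)

text \<open>This is polarization: expanding \<open>x y \<otimes> (- x y)\<close> and removing
  \<open>x \<otimes> (-x)\<close> and \<open>y \<otimes> (-y)\<close> leaves
  \<open>x \<otimes> y + y \<otimes> x\<close>.\<close>

lemma suslin_wedge_rel_subset_wedge_rel:
  "(suslin_wedge_rel :: (('f::field \<times> 'f) \<Rightarrow>\<^sub>0 int) set set) \<subseteq> wedge_rel"
  unfolding suslin_wedge_rel_def
proof (rule units.T.generate_subgroup_incl[OF _ subgroup_wedge_rel], safe)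
  fix x y :: 'f
  assume xy: "x \<noteq> 0" "y \<noteq> 0"
  have diag: "ptensor a (- a) \<in> wedge_rel" if "a \<noteq> 0" for a :: 'f
    unfolding wedge_rel_def using that by (intro generate.incl) blast
  let ?p = "ptensor x (- x) \<otimes>\<^bsub>FxF\<^esub> ptensor y (- y)"
  let ?q = "ptensor x y \<otimes>\<^bsub>FxF\<^esub> ptensor y x"
  note closed = ptensor_closed[of x y] ptensor_closed[of y x]
    ptensor_closed[of x "- x"] ptensor_closed[of y "- y"]
  have p: "?p \<in> wedge_rel"
    using xy by (intro subgroup.m_closed[OF subgroup_wedge_rel] diag)
  \<comment> \<open>The sign is attached to \<open>x\<close> in the first summand and to
    \<open>y\<close> in the second, so that the diagonal elements at \<open>x\<close> and at
    \<open>y\<close> split off.\<close>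
  have "ptensor (x * y) (- (x * y)) = ptensor x ((- x) * y) \<otimes>\<^bsub>FxF\<^esub> ptensor y (x * (- y))"
    using xy by (simp add: ptensor_mult_left)
  also have "\<dots> = (ptensor x (- x) \<otimes>\<^bsub>FxF\<^esub> ptensor x y) \<otimes>\<^bsub>FxF\<^esub>
      (ptensor y x \<otimes>\<^bsub>FxF\<^esub> ptensor y (- y))"
    using xy ptensor_mult_right[of x "- x" y] ptensor_mult_right[of y x "- y"] by simp
  also have "\<dots> = ?p \<otimes>\<^bsub>FxF\<^esub> ?q"
    using xy closed by (simp add: units.T.m_ac)
  finally have "?q = inv\<^bsub>FxF\<^esub> ?p \<otimes>\<^bsub>FxF\<^esub> ptensor (x * y) (- (x * y))"
    using xy closed by (simp add: units.T.inv_solve_left)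
  also have "\<dots> \<in> wedge_rel"
    using subgroup.m_inv_closed[OF subgroup_wedge_rel p] diag[of "x * y"] xy
    by (intro subgroup.m_closed[OF subgroup_wedge_rel]) auto
  finally show "?q \<in> wedge_rel" .
qed

lemma double_wedge_rel:
  assumes "t \<in> wedge_rel"
  shows "t [^]\<^bsub>FxF\<^esub> (2::nat) \<in> suslin_wedge_rel"
proof (rule units.T.generate_nat_pow_subset[OF subgroup_suslin_wedge_rel])
  fix t :: "(('a \<times> 'a) \<Rightarrow>\<^sub>0 int) set"
  assume "t \<in> {ptensor a (- a) | a. a \<noteq> 0}"
  then obtain a where a: "t = ptensor a (- a)" "a \<noteq> 0"
    by blast
  have "t [^]\<^bsub>FxF\<^esub> (2::nat) = t \<otimes>\<^bsub>FxF\<^esub> t"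
    using a ptensor_closed[of a "- a"] by (simp add: numeral_2_eq_2)
  \<comment> \<open>Both sides equal \<open>ptensor a (a * a)\<close>, since
    \<open>(- a) * (- a) = a * a\<close>. The right side is Suslin's generator with \<open>x\<close>
    and \<open>y\<close> both equal to \<open>a\<close>.\<close>
  also have "\<dots> = ptensor a a \<otimes>\<^bsub>FxF\<^esub> ptensor a a"
    using ptensor_mult_right[of a a a] ptensor_mult_right[of a "- a" "- a"] a by simp
  also have "\<dots> \<in> suslin_wedge_rel"
    unfolding suslin_wedge_rel_def using a by (intro generate.incl) blast
  finally show "t [^]\<^bsub>FxF\<^esub> (2::nat) \<in> suslin_wedge_rel" .
qed (use assms in \<open>auto simp: wedge_rel_def ptensor_closed\<close>)

text \<open>A common lift of both boundary maps to the tensor square. Both kernels become preimages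
  under this one map, so they can be compared through the subgroups \<open>wedge_rel\<close> and
  \<open>suslin_wedge_rel\<close>.\<close>

definition tensor_symbol :: "('f::field \<Rightarrow>\<^sub>0 int) \<Rightarrow> (('f \<times> 'f) \<Rightarrow>\<^sub>0 int) set" where
  "tensor_symbol = free_lift FxF (\<lambda>a. ptensor a (1 - a))"

lemma tensor_symbol_hom: "tensor_symbol \<in> hom ZF (FxF :: (('f::field \<times> 'f) \<Rightarrow>\<^sub>0 int) set monoid)"
  and tensor_symbol_frag_of: "(a :: 'f) \<notin> {0, 1} \<Longrightarrow> tensor_symbol (frag_of a) = ptensor a (1 - a)"
proof -
  have f: "(\<lambda>a. ptensor a (1 - a)) \<in> UNIV - {0, 1} \<rightarrow> carrier (FxF :: (('f \<times> 'f) \<Rightarrow>\<^sub>0 int) set monoid)"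
    by (auto simp: ptensor_closed)
  show "tensor_symbol \<in> hom ZF (FxF :: (('f \<times> 'f) \<Rightarrow>\<^sub>0 int) set monoid)"
    unfolding tensor_symbol_def ZF_def by (rule free_lift_hom(1)[OF units.T.comm_group_axioms f])
  show "tensor_symbol (frag_of a) = ptensor a (1 - a)" if "a \<notin> {0, 1}" for a :: 'f
    unfolding tensor_symbol_def
    using free_lift_hom(2)[OF units.T.comm_group_axioms f] that by blast
qed

text \<open>On basis elements \<open>d\<close> agrees with \<open>tensor_symbol\<close> followed by
  reduction modulo \<open>W\<close>, hence everywhere.\<close>

lemma kernel_coset_tensor_symbol:
  assumes "subgroup W (FxF :: (('f::field \<times> 'f) \<Rightarrow>\<^sub>0 int) set monoid)"
    and "d \<in> hom ZF (FxF Mod W)"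
    and "\<And>a. a \<notin> {0, 1} \<Longrightarrow> d (frag_of a) = W #>\<^bsub>FxF\<^esub> ptensor a (1 - a)"
  shows "kernel ZF (FxF Mod W) d = {c \<in> carrier ZF. tensor_symbol c \<in> W}"
proof -
  interpret W: group_hom FxF "FxF Mod W" "\<lambda>t. W #>\<^bsub>FxF\<^esub> t"
    by (rule units.T.group_hom_r_coset[OF assms(1)])
  have d: "d c = W #>\<^bsub>FxF\<^esub> tensor_symbol c" if "c \<in> carrier ZF" for c
  proof -
    have "d c = ((\<lambda>t. W #>\<^bsub>FxF\<^esub> t) \<circ> tensor_symbol) c"
      using W.H.is_group assms(2) Group.hom_compose[OF tensor_symbol_hom W.homh] _ that
      unfolding ZF_def
      by (rule hom_free_Abelian_group_eqI) (simp add: assms(3) tensor_symbol_frag_of)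
    then show ?thesis
      by simp
  qed
  have "W #>\<^bsub>FxF\<^esub> tensor_symbol c = W \<longleftrightarrow> tensor_symbol c \<in> W" if "c \<in> carrier ZF" for c
    using units.T.coset_join1[OF _ hom_in_carrier[OF tensor_symbol_hom that] assms(1)]
      units.T.coset_join2[OF hom_in_carrier[OF tensor_symbol_hom that] assms(1)]
    by (rule iffI)
  then show ?thesis
    unfolding kernel_def one_FactGroup using d by (intro Collect_cong) (metis)
qed

lemma bloch_ker_eq: "bloch_ker = {c \<in> carrier ZF. tensor_symbol c \<in> wedge_rel}"
  using kernel_coset_tensor_symbol[OF subgroup_wedge_rel] bloch_boundary_hom bloch_boundary_frag_of
  unfolding bloch_ker_def wedge_group_def by blast

lemma suslin_ker_eq: "suslin_ker = {c \<in> carrier ZF. tensor_symbol c \<in> suslin_wedge_rel}"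
  using kernel_coset_tensor_symbol[OF subgroup_suslin_wedge_rel]
    suslin_boundary_hom suslin_boundary_frag_of
  unfolding suslin_ker_def suslin_wedge_group_def by blast

lemma subgroup_bloch_ker: "subgroup bloch_ker ZF"
  unfolding bloch_ker_def
  using comm_group.axioms(2)[OF comm_group_ZF] bloch_boundary_hom
    comm_group.axioms(2)[OF units.T.abelian_FactGroup[OF subgroup_wedge_rel]]
  by (intro group_hom.subgroup_kernel) (simp add: group_hom_def group_hom_axioms_def wedge_group_def)

lemma subgroup_suslin_ker: "subgroup suslin_ker ZF"
  unfolding suslin_ker_def
  using comm_group.axioms(2)[OF comm_group_ZF] suslin_boundary_hom
    comm_group.axioms(2)[OF units.T.abelian_FactGroup[OF subgroup_suslin_wedge_rel]]
  by (intro group_hom.subgroup_kernel)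
    (simp add: group_hom_def group_hom_axioms_def suslin_wedge_group_def)

lemma suslin_ker_subset_bloch_ker: "suslin_ker \<subseteq> bloch_ker"
  unfolding suslin_ker_eq bloch_ker_eq using suslin_wedge_rel_subset_wedge_rel by blast

lemma double_bloch_ker:
  assumes "c \<in> bloch_ker"
  shows "c [^]\<^bsub>ZF\<^esub> (2::nat) \<in> suslin_ker"
proof -
  interpret ZF: comm_group ZF by (rule comm_group_ZF)
  have c: "c \<in> carrier ZF" "tensor_symbol c \<in> wedge_rel"
    using assms unfolding bloch_ker_eq by blast+
  have "tensor_symbol (c [^]\<^bsub>ZF\<^esub> (2::nat)) = tensor_symbol c [^]\<^bsub>FxF\<^esub> (2::nat)"
    by (rule hom_nat_pow[OF tensor_symbol_hom c(1) ZF.is_group units.T.is_group])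
  then show ?thesis
    unfolding suslin_ker_eq using double_wedge_rel[OF c(2)] ZF.nat_pow_closed[OF c(1)] by simp
qed

section \<open>Comparison of the two Bloch groups\<close>

theorem theorem2p1:
  shows "(\<exists>h \<in> hom (suslin_bloch_group :: ('f::field_char_0 \<Rightarrow>\<^sub>0 int) set monoid) bloch_group.
            induced_by_identity h \<and>
            torsion_kernel_cokernel suslin_bloch_group bloch_group h) \<and>
         tensor_group (bloch_group :: ('f \<Rightarrow>\<^sub>0 int) set monoid) Z_inv6
           \<cong> tensor_group (suslin_bloch_group :: ('f \<Rightarrow>\<^sub>0 int) set monoid) Z_inv6"
proof -
  let ?S = "suslin_bloch_group :: ('f \<Rightarrow>\<^sub>0 int) set monoid"
  let ?B = "bloch_group :: ('f \<Rightarrow>\<^sub>0 int) set monoid"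
  interpret ZF: comm_group "ZF :: ('f \<Rightarrow>\<^sub>0 int) monoid"
    by (rule comm_group_ZF)
  have S: "comm_group ?S"
    unfolding suslin_bloch_group_def
    by (rule ZF.comm_group_subquotient[OF subgroup_suslin_ker subgroup_suslin_rel])
  have B: "comm_group ?B"
    unfolding bloch_group_def
    by (rule ZF.comm_group_subquotient[OF subgroup_bloch_ker subgroup_bloch_rel])
  \<comment> \<open>The factor 6 carries \<open>bloch_rel\<close> into \<open>suslin_rel\<close> and
    the factor 2 carries \<open>bloch_ker\<close> into \<open>suslin_ker\<close>; their product 12
    does both, as \<open>subquotient_hom\<close> demands.\<close>
  have pow12: "c [^]\<^bsub>ZF\<^esub> (12::nat) = (c [^]\<^bsub>ZF\<^esub> (6::nat)) [^]\<^bsub>ZF\<^esub> (2::nat)"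
    if "c \<in> carrier ZF" for c :: "'f \<Rightarrow>\<^sub>0 int"
    using ZF.nat_pow_pow[OF that, of 6 2] by simp
  have rel6: "c [^]\<^bsub>ZF\<^esub> (6::nat) \<in> suslin_rel" if "c \<in> bloch_rel" for c :: "'f \<Rightarrow>\<^sub>0 int"
    using six_bloch_rel[OF that] by (simp only: nat_pow_ZF of_nat_numeral)
  have rel12: "c [^]\<^bsub>ZF\<^esub> (12::nat) \<in> suslin_rel" if "c \<in> bloch_rel" for c :: "'f \<Rightarrow>\<^sub>0 int"
    unfolding pow12[OF subgroup.mem_carrier[OF subgroup_bloch_rel that]]
    by (rule ZF.subgroup_nat_pow_closed[OF subgroup_suslin_rel rel6[OF that]])
  have ker12: "c [^]\<^bsub>ZF\<^esub> (12::nat) \<in> suslin_ker" if "c \<in> bloch_ker" for c :: "'f \<Rightarrow>\<^sub>0 int"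
    unfolding pow12[OF subgroup.mem_carrier[OF subgroup_bloch_ker that]]
    by (rule double_bloch_ker[OF ZF.subgroup_nat_pow_closed[OF subgroup_bloch_ker that]])
  obtain h where h: "h \<in> hom ?S ?B"
    "\<And>c. c \<in> suslin_ker \<Longrightarrow> h (suslin_rel #>\<^bsub>ZF\<^esub> c) = bloch_rel #>\<^bsub>ZF\<^esub> c"
    using ZF.subquotient_hom[of "\<lambda>c. c" suslin_rel bloch_rel suslin_ker bloch_ker]
      subgroup_suslin_rel subgroup_bloch_rel suslin_rel_subset_bloch_rel
      suslin_ker_subset_bloch_ker subgroup.subset[OF subgroup_suslin_ker]
    unfolding suslin_bloch_group_def bloch_group_def by (auto simp: hom_def)
  obtain g where g: "g \<in> hom ?B ?S"
    "\<And>c. c \<in> bloch_ker \<Longrightarrow> g (bloch_rel #>\<^bsub>ZF\<^esub> c) = suslin_rel #>\<^bsub>ZF\<^esub> (c [^]\<^bsub>ZF\<^esub> (12::nat))"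
    using ZF.subquotient_hom[OF ZF.nat_pow_hom[of 12] subgroup_bloch_rel subgroup_suslin_rel,
        of bloch_ker suslin_ker]
      rel12 ker12 subgroup.subset[OF subgroup_bloch_ker]
    unfolding suslin_bloch_group_def bloch_group_def by blast
  have carrier_S: "\<exists>c \<in> suslin_ker. z = suslin_rel #>\<^bsub>ZF\<^esub> c" if "z \<in> carrier ?S" for z
    using that unfolding suslin_bloch_group_def carrier_subquotient by blast
  have carrier_B: "\<exists>c \<in> bloch_ker. z = bloch_rel #>\<^bsub>ZF\<^esub> c" if "z \<in> carrier ?B" for z
    using that unfolding bloch_group_def carrier_subquotient by blast
  have pow_S: "(suslin_rel #>\<^bsub>ZF\<^esub> c) [^]\<^bsub>?S\<^esub> (n::nat) = suslin_rel #>\<^bsub>ZF\<^esub> (c [^]\<^bsub>ZF\<^esub> n)"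
    if "c \<in> suslin_ker" for c n
    unfolding suslin_bloch_group_def
    by (intro ZF.subquotient_pow subgroup_suslin_rel subgroup.mem_carrier[OF subgroup_suslin_ker that])
  have pow_B: "(bloch_rel #>\<^bsub>ZF\<^esub> c) [^]\<^bsub>?B\<^esub> (n::nat) = bloch_rel #>\<^bsub>ZF\<^esub> (c [^]\<^bsub>ZF\<^esub> n)"
    if "c \<in> bloch_ker" for c n
    unfolding bloch_group_def
    by (intro ZF.subquotient_pow subgroup_bloch_rel subgroup.mem_carrier[OF subgroup_bloch_ker that])
  have gh: "g (h z) = z [^]\<^bsub>?S\<^esub> (12::nat)" if "z \<in> carrier ?S" for z
    using carrier_S[OF that] suslin_ker_subset_bloch_ker by (auto simp: g(2) h(2) pow_S)
  have hg: "h (g z) = z [^]\<^bsub>?B\<^esub> (12::nat)" if "z \<in> carrier ?B" for z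
    using carrier_B[OF that] by (auto simp: g(2) h(2) pow_B ker12)
  \<comment> \<open>A class killed by \<open>h\<close> is represented by an element of
    \<open>bloch_rel\<close>, whose multiple by 6 is in \<open>suslin_rel\<close>.\<close>
  have "z [^]\<^bsub>?S\<^esub> (6::nat) = \<one>\<^bsub>?S\<^esub>" if z: "z \<in> carrier ?S" "h z = \<one>\<^bsub>?B\<^esub>" for z
  proof -
    obtain c where c: "c \<in> suslin_ker" "z = suslin_rel #>\<^bsub>ZF\<^esub> c"
      using carrier_S[OF z(1)] by blast
    have cZ: "c \<in> carrier ZF"
      by (rule subgroup.mem_carrier[OF subgroup_suslin_ker c(1)])
    have "bloch_rel #>\<^bsub>ZF\<^esub> c = bloch_rel"
      using z(2) c h(2) by (simp add: bloch_group_def)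
    then have "c \<in> bloch_rel"
      using ZF.coset_join1[OF _ cZ subgroup_bloch_rel] by blast
    then have "suslin_rel #>\<^bsub>ZF\<^esub> (c [^]\<^bsub>ZF\<^esub> (6::nat)) = suslin_rel"
      by (intro ZF.coset_join2 ZF.nat_pow_closed cZ subgroup_suslin_rel rel6)
    then show ?thesis
      unfolding c(2) pow_S[OF c(1)] by (simp add: suslin_bloch_group_def)
  qed
  \<comment> \<open>The kernel has exponent 6 by the previous step, and the cokernel is killed by 12
    because the 12th power of \<open>y\<close> is \<open>h (g y)\<close>.\<close>
  then have "torsion_kernel_cokernel ?S ?B h"
    using hg[symmetric] hom_in_carrier[OF g(1)]
    by (intro torsion_kernel_cokernelI[OF S B h(1), of 6 12]) auto
  moreover have "tensor_group ?B Z_inv6 \<cong> tensor_group ?S Z_inv6"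
    by (rule tensor_iso_of_mutual_power[OF B S comm_group_Z_inv6 g(1) h(1) hg gh Z_inv6_div12_hom])
      (simp_all add: Z_inv6_pow)
  ultimately show ?thesis
    using h by (auto simp: induced_by_identity_def)
qed

end
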